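(* Let $\phi=\frac{\sqrt5+1}{2}$, let $L_{2n}=\phi^{2n}+\phi^{-2n}$, and for integers $A,B$ let $v_n(A,B)$ be the Lucas sequence. Then \begin{align*} &\sum_{n=1}^\infty\frac{L_{2n}}{n^2\binom{2n}{n}}(H_{2n}-H_{n-1})=\frac{41\zeta(3)+4\pi^2\log\phi}{25},\\ &\sum_{n=1}^\infty\frac{v_n(5,5)}{n^2\binom{2n}{n}}(H_{2n}-H_{n-1})=\frac{124\zeta(3)+\pi^2\log(5^5\phi^6)}{50},\\ &\sum_{n=1}^\infty\frac{v_n(4,1)}{n^2\binom{2n}{n}}(H_{2n}-H_{n-1})=\frac{23\zeta(3)+2\pi^2\log(2+\sqrt3)}{12},\\ &\sum_{n=1}^\infty\frac{v_n(4,2)}{n^2\binom{2n}{n}}(H_{2n}-H_{n-1})=\frac{259\zeta(3)+2\pi^2\big(5\log2+8\log(1+\sqrt2)\big)}{128}. \end{align*}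
   Context: The Lucas sequence $v_n(A,B)$ is defined by $v_0=2$, $v_1=A$, $v_{n+1}=Av_n-Bv_{n-1}$ for $n\ge1$; equivalently $v_n(A,B)=\alpha^n+\beta^n$ where $\alpha,\beta$ are the roots of $x^2-Ax+B=0$. $H_0=0$ and $H_n=\sum_{k=1}^n 1/k$ are the harmonic numbers; $\zeta$ is the Riemann zeta function. *)

theory Defs
  imports "HOL-Analysis.Analysis"
begin

fun lucas_v :: "int \<Rightarrow> int \<Rightarrow> nat \<Rightarrow> int" where
  "lucas_v A B 0 = 2"
| "lucas_v A B (Suc 0) = A"
| "lucas_v A B (Suc (Suc n)) = A * lucas_v A B (Suc n) - B * lucas_v A B n"

text \<open>The Riemann zeta function on real arguments \<open>s > 1\<close>, where the Dirichlet series converges;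
  no meaning is intended for other \<open>s\<close>.\<close>

definition zeta :: "real \<Rightarrow> real" where
  "zeta s = (\<Sum>n. 1 / real (Suc n) powr s)"

text \<open>Meant for \<open>n \<ge> 1\<close> only, so that \<open>n - 1\<close> does not truncate.\<close>

definition binomial_harm_term :: "(nat \<Rightarrow> real) \<Rightarrow> nat \<Rightarrow> real" where
  "binomial_harm_term a n =
     a n / (real n ^ 2 * real ((2 * n) choose n)) * (harm (2 * n) - harm (n - 1))"

end

theory Submission
  imports Defs "HOL-Real_Asymp.Real_Asymp"
begin

text \<open>
  For \<open>0 < t < \<pi>/2\<close> the sum of \<open>x\<^sup>n (H\<^bsub>2n\<^esub> - H\<^bsub>n-1\<^esub>) / (n\<^sup>2 binom(2n,n))\<close> at \<open>x = 4 sin\<^sup>2 t\<close> equals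
  \<open>\<zeta>(3) - C(2t) + t\<^sup>2 ln (4 sin\<^sup>2 t)\<close>, where \<open>C(y)\<close> is the sum of \<open>cos(n y) / n\<^sup>3\<close>. Both sides vanish as
  \<open>t\<close> tends to \<open>0\<close>. Half their derivatives agree, because these vanish at \<open>0\<close> too and have the common derivative
  \<open>4 t cot t - t\<^sup>2 / sin\<^sup>2 t\<close>: on the left this is a recurrence between coefficients, which reduces
  the harmonic numbers to the series of \<open>arcsin\<close> and \<open>arcsin\<^sup>2\<close>; on the right the logarithms cancel
  because \<open>C''(y) = ln (2 sin (y/2))\<close>. The roots of \<open>x\<^sup>2 - A x + B\<close> in the four cases are
  \<open>4 sin\<^sup>2 t = 2 - 2 cos y\<close> for two rational multiples \<open>y = 2t\<close> of \<open>\<pi>\<close>, at which the distribution relation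
  for \<open>C\<close> turns the sum of both values of \<open>C\<close> into a rational multiple of \<open>\<zeta>(3)\<close>.
\<close>

section \<open>Power series in the squared sine\<close>

text \<open>Boundedness is the only growth information carried along for coefficients: comparison
  with a geometric series then covers every w = sin^2 t with |t| < pi/2.\<close>

lemma summable_bounded_coeffs:
  fixes c :: "nat \<Rightarrow> real"
  assumes "\<And>n. \<bar>c n\<bar> \<le> M" and "\<bar>w\<bar> < 1"
  shows "summable (\<lambda>n. c n * w ^ n)"
proof (rule summable_comparison_test')
  show "summable (\<lambda>n. M * \<bar>w\<bar> ^ n)"
    using assms(2) by (intro summable_mult summable_geometric) simp
  show "norm (c n * w ^ n) \<le> M * \<bar>w\<bar> ^ n" for n
    using assms(1)[of n] by (simp add: abs_mult power_abs mult_right_mono)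
qed

lemma DERIV_bounded_power_series:
  fixes c :: "nat \<Rightarrow> real"
  assumes "\<And>n. \<bar>c n\<bar> \<le> M" and "\<bar>w\<bar> < 1"
  shows "((\<lambda>x. \<Sum>n. c n * x ^ n) has_real_derivative
           (\<Sum>n. real (Suc n) * c (Suc n) * w ^ n)) (at w)"
proof -
  have "((\<lambda>x. \<Sum>n. c n * x ^ n) has_real_derivative (\<Sum>n. diffs c n * w ^ n)) (at w)"
    using assms by (intro termdiffs_strong'[where K = 1] summable_bounded_coeffs) auto
  then show ?thesis
    by (simp add: diffs_def)
qed

lemma sin_squared_less_1:
  fixes t :: real
  assumes "\<bar>t\<bar> < pi / 2"
  shows "\<bar>(sin t)\<^sup>2\<bar> < 1"
proof -
  have "cos t > 0"
    using assms by (intro cos_gt_zero_pi) auto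
  then have "(cos t)\<^sup>2 > 0"
    by (rule zero_less_power)
  then show ?thesis
    using sin_cos_squared_add[of t] zero_le_power2[of "sin t"] by linarith
qed

lemma DERIV_sin_squared_series:
  fixes c :: "nat \<Rightarrow> real"
  assumes "\<And>n. \<bar>c n\<bar> \<le> M" and "\<bar>t\<bar> < pi / 2"
  shows "((\<lambda>t. \<Sum>n. c n * ((sin t)\<^sup>2) ^ n) has_real_derivative
           2 * (sin t * cos t * (\<Sum>n. real (Suc n) * c (Suc n) * ((sin t)\<^sup>2) ^ n))) (at t)"
proof -
  have "((\<lambda>t. (sin t)\<^sup>2) has_real_derivative 2 * (sin t * cos t)) (at t)"
    by (auto intro!: derivative_eq_intros)
  from DERIV_chain2[OF DERIV_bounded_power_series[of c M, OF assms(1) sin_squared_less_1[OF assms(2)]] this]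
  show ?thesis
    by (simp add: mult_ac)
qed

text \<open>With w = sin^2 t and g the series in w, the product rule gives the derivative (1 - 2w) g
  + 2w(1 - w) g'. Rearranged as g + 2w g' - 2w (w g' + g), its coefficient at w^n is the one in the
  hypothesis, so a differential equation for the sum becomes a two-term recurrence for
  \<open>c\<close>.\<close>

lemma DERIV_sin_cos_series:
  fixes c :: "nat \<Rightarrow> real"
  assumes c: "\<And>n. \<bar>c n\<bar> \<le> M" and t: "\<bar>t\<bar> < pi / 2"
    and D: "(\<lambda>n. (real (2 * n + 1) * c n - real (2 * n) * c (n - 1)) * ((sin t)\<^sup>2) ^ n) sums D"
  shows "((\<lambda>t. sin t * cos t * (\<Sum>n. c n * ((sin t)\<^sup>2) ^ n)) has_real_derivative D) (at t)"
proof -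
  define w where "w = (sin t)\<^sup>2"
  define g where "g = (\<Sum>n. c n * w ^ n)"
  define g' where "g' = (\<Sum>n. real (Suc n) * c (Suc n) * w ^ n)"
  have w: "\<bar>w\<bar> < 1"
    using sin_squared_less_1[OF t] by (simp add: w_def)
  have g: "(\<lambda>n. c n * w ^ n) sums g"
    unfolding g_def using summable_bounded_coeffs[OF c w] by (rule summable_sums)
  have "summable (\<lambda>n. diffs c n * w ^ n)"
    by (rule termdiff_converges[where K = 1]) (use w c summable_bounded_coeffs in auto)
  then have "(\<lambda>n. real (Suc n) * c (Suc n) * w ^ n) sums g'"
    unfolding g'_def by (simp add: diffs_def summable_sums)
  from sums_mult[OF this, of w] have "(\<lambda>n. real (Suc n) * c (Suc n) * w ^ Suc n) sums (w * g')"
    by (simp add: mult_ac)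
  then have wg': "(\<lambda>n. real n * c n * w ^ n) sums (w * g')"
    by (subst (asm) sums_Suc_iff) simp
  have "(\<lambda>n. w * (real n * c n * w ^ n + c n * w ^ n)) sums (w * (w * g' + g))"
    by (intro sums_mult sums_add wg' g)
  then have "(\<lambda>n. real (Suc n) * c (Suc n - 1) * w ^ Suc n) sums (w * (w * g' + g))"
    by (simp add: algebra_simps)
  \<comment> \<open>At n = 0 the truncated \<open>c (n - 1)\<close> is \<open>c 0\<close>, but the
    factor n removes it.\<close>
  then have shifted: "(\<lambda>n. real n * c (n - 1) * w ^ n) sums (w * (w * g' + g))"
    by (subst (asm) sums_Suc_iff) simp
  have "(\<lambda>n. 2 * (real n * c n * w ^ n) + c n * w ^ n - 2 * (real n * c (n - 1) * w ^ n))
          sums (2 * (w * g') + g - 2 * (w * (w * g' + g)))"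
    by (intro sums_diff sums_add sums_mult wg' g shifted)
  then have "(\<lambda>n. (real (2 * n + 1) * c n - real (2 * n) * c (n - 1)) * w ^ n)
          sums (2 * (w * g') + g - 2 * (w * (w * g' + g)))"
    by (simp add: algebra_simps)
  with D have D': "D = 2 * (w * g') + g - 2 * (w * (w * g' + g))"
    unfolding w_def by (rule sums_unique2)
  have cos2: "(cos t)\<^sup>2 = 1 - w"
    by (simp add: w_def cos_squared_eq)
  have "((\<lambda>t. \<Sum>n. c n * ((sin t)\<^sup>2) ^ n) has_real_derivative 2 * (sin t * cos t * g')) (at t)"
    using DERIV_sin_squared_series[of c M, OF c t] by (simp add: g'_def w_def)
  then have "((\<lambda>t. sin t * cos t * (\<Sum>n. c n * ((sin t)\<^sup>2) ^ n)) has_real_derivative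
      ((cos t)\<^sup>2 - (sin t)\<^sup>2) * g + 2 * ((sin t)\<^sup>2 * (cos t)\<^sup>2) * g') (at t)"
    by (auto intro!: derivative_eq_intros simp: g_def w_def power2_eq_square algebra_simps)
  also have "((cos t)\<^sup>2 - (sin t)\<^sup>2) * g + 2 * ((sin t)\<^sup>2 * (cos t)\<^sup>2) * g' = D"
    unfolding D' cos2 w_def[symmetric] by (simp add: algebra_simps)
  finally show ?thesis .
qed

section \<open>Coefficients of the arcsine series and their harmonic variant\<close>

definition arcsin_coeff :: "nat \<Rightarrow> real" where
  "arcsin_coeff n = 4 ^ Suc n / (real (Suc n) * real ((2 * Suc n) choose Suc n))"

text \<open>Index n belongs to the summand n + 1 of the final series, so H_{2n} - H_{n-1} appears
  here without a truncated subtraction.\<close>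

definition arcsin_harm_coeff :: "nat \<Rightarrow> real" where
  "arcsin_harm_coeff n = arcsin_coeff n * (harm (2 * Suc n) - harm n)"

lemma central_binomial_Suc:
  "Suc n * ((2 * Suc n) choose Suc n) = 2 * (2 * n + 1) * ((2 * n) choose n)"
proof -
  have "Suc n * (Suc n * ((2 * Suc n) choose Suc n)) = Suc n * (2 * (2 * n + 1) * ((2 * n) choose n))"
    using Suc_times_binomial_eq[of "Suc (2 * n)" n] Suc_times_binomial_add[of n n]
      Suc_times_binomial[of n "2 * n"] 
    by (simp add: algebra_simps) 
  then show ?thesis
    by (metis mult_cancel1 nat.distinct(1))
qed

lemma arcsin_coeff_0: "arcsin_coeff 0 = 2"
  by (simp add: arcsin_coeff_def)

text \<open>This is exactly the vanishing of the coefficients of positive index in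
  \<open>DERIV_sin_cos_series\<close>.\<close>

lemma arcsin_coeff_Suc:
  "real (2 * Suc n + 1) * arcsin_coeff (Suc n) = real (2 * Suc n) * arcsin_coeff n"
proof -
  define C where "C = real ((2 * Suc n) choose Suc n)"
  define C' where "C' = real ((2 * Suc (Suc n)) choose Suc (Suc n))"
  have "C > 0"
    by (simp add: C_def del: binomial_Suc_Suc mult_Suc_right)
  have "real (Suc (Suc n)) * C' = 2 * real (2 * Suc n + 1) * C"
    unfolding C_def C'_def using central_binomial_Suc[of "Suc n"]
    by (metis of_nat_mult of_nat_numeral)
  then have Suc: "arcsin_coeff (Suc n) = 4 ^ Suc (Suc n) / (2 * real (2 * Suc n + 1) * C)"
    unfolding arcsin_coeff_def C'_def[symmetric] by simp
  have n: "arcsin_coeff n = 4 ^ Suc n / (real (Suc n) * C)"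
    unfolding arcsin_coeff_def C_def[symmetric] ..
  show ?thesis
    unfolding Suc n using \<open>C > 0\<close> by (simp add: divide_simps) (simp add: algebra_simps)
qed

lemma arcsin_coeff_bounds: "0 < arcsin_coeff n \<and> arcsin_coeff n \<le> 2"
proof (induction n)
  case 0
  then show ?case by (simp add: arcsin_coeff_0)
next
  case (Suc n)
  have "arcsin_coeff (Suc n) = real (2 * Suc n) / real (2 * Suc n + 1) * arcsin_coeff n"
    using arcsin_coeff_Suc[of n] by (simp add: field_simps)
  moreover have "real (2 * Suc n) / real (2 * Suc n + 1) * arcsin_coeff n \<le> 1 * arcsin_coeff n"
    using Suc by (intro mult_right_mono) auto
  moreover have "real (2 * Suc n) / real (2 * Suc n + 1) * arcsin_coeff n > 0"
    using Suc by (intro mult_pos_pos divide_pos_pos) auto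
  ultimately show ?case
    using Suc by linarith
qed

lemma harm_diff_Suc:
  "harm (2 * Suc (Suc n)) - harm (Suc n) =
     (harm (2 * Suc n) - harm n + 1 / real (2 * Suc n + 1) + 1 / real (2 * Suc n + 2) - 1 / real (Suc n) :: real)"
  by (simp add: harm_Suc inverse_eq_divide)

text \<open>The difference starts at H_2 = 3/2 and decreases: two new reciprocals, each at most
  1/(2(n+1)), enter while 1/(n+1) leaves.\<close>

lemma harm_diff_bounds: "(0 :: real) \<le> harm (2 * Suc n) - harm n \<and> harm (2 * Suc n) - harm n \<le> (2 :: real)"
proof
  show "0 \<le> harm (2 * Suc n) - (harm n :: real)"
    using harm_mono[of n "2 * Suc n", where ?'a = real] by simp
  show "harm (2 * Suc n) - harm n \<le> (2 :: real)"
  proof (induction n)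
    case 0
    then show ?case by (simp add: harm_expand)
  next
    case (Suc n)
    have "1 / real (2 * Suc n + 1) + 1 / real (2 * Suc n + 2) \<le> 1 / real (2 * Suc n) + 1 / real (2 * Suc n)"
      by (intro add_mono divide_left_mono) simp_all
    also have "\<dots> = 1 / real (Suc n)"
      by (simp add: field_simps)
    finally have "h + 1 / real (2 * Suc n + 1) + 1 / real (2 * Suc n + 2) - 1 / real (Suc n) \<le> h" for h
      by simp
    then show ?case
      unfolding harm_diff_Suc using Suc by (rule order_trans)
  qed
qed

lemma arcsin_harm_coeff_bounded: "\<bar>arcsin_harm_coeff n\<bar> \<le> 4"
proof -
  have "\<bar>arcsin_harm_coeff n\<bar> = arcsin_coeff n * (harm (2 * Suc n) - harm n)"
    unfolding arcsin_harm_coeff_def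
    using arcsin_coeff_bounds[of n] harm_diff_bounds[of n] by (intro abs_of_nonneg mult_nonneg_nonneg) linarith+
  also have "\<dots> \<le> 2 * 2"
    using arcsin_coeff_bounds[of n] harm_diff_bounds[of n] by (intro mult_mono) auto
  finally show ?thesis by simp
qed

text \<open>By the recurrence only the constant coefficient 2 survives in the derivative of the left
  side, and both sides vanish at 0. In x = sin t this is the series of arcsin x / (x sqrt(1 -
  x^2)).\<close>

lemma sin_cos_arcsin_series:
  assumes t: "\<bar>t\<bar> < pi / 2"
  shows "sin t * cos t * (\<Sum>n. arcsin_coeff n * ((sin t)\<^sup>2) ^ n) = 2 * t"
proof -
  let ?f = "\<lambda>t. sin t * cos t * (\<Sum>n. arcsin_coeff n * ((sin t)\<^sup>2) ^ n) - 2 * t"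
  have "(?f has_real_derivative 0) (at u)" if "u \<in> {-(pi/2)<..<pi/2}" for u
  proof -
    have "(\<lambda>n. (real (2 * n + 1) * arcsin_coeff n - real (2 * n) * arcsin_coeff (n - 1)) * ((sin u)\<^sup>2) ^ n) sums 2"
    proof (rule sums_cong[THEN iffD1])
      show "(\<lambda>n. if n = 0 then 2 else 0 :: real) sums 2"
        using sums_single[of 0 "\<lambda>_. 2 :: real"] by simp
      show "(if n = 0 then 2 else 0) =
          (real (2 * n + 1) * arcsin_coeff n - real (2 * n) * arcsin_coeff (n - 1)) * ((sin u)\<^sup>2) ^ n" for n
        using arcsin_coeff_Suc[of "n - 1"] by (cases n) (auto simp: arcsin_coeff_0)
    qed
    moreover have "\<bar>arcsin_coeff n\<bar> \<le> 2" for n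
      using arcsin_coeff_bounds[of n] by simp
    moreover have "\<bar>u\<bar> < pi / 2"
      using that by auto
    ultimately have "((\<lambda>t. sin t * cos t * (\<Sum>n. arcsin_coeff n * ((sin t)\<^sup>2) ^ n)) has_real_derivative 2) (at u)"
      by (intro DERIV_sin_cos_series)
    from DERIV_diff[OF this, of "\<lambda>t. 2 * t" 2] show ?thesis
      by (auto intro!: derivative_eq_intros)
  qed
  then have "?f t = ?f 0"
    using t by (intro DERIV_isconst3[of "-(pi/2)" "pi/2"]) auto
  then show ?thesis
    by simp
qed

text \<open>Integrates the preceding identity: the chain rule turns it into the derivative 4t of the
  series.\<close>

lemma arcsin_squared_series:
  assumes t: "\<bar>t\<bar> < pi / 2"
  shows "(sin t)\<^sup>2 * (\<Sum>n. arcsin_coeff n / real (Suc n) * ((sin t)\<^sup>2) ^ n) = 2 * t\<^sup>2"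
proof -
  \<comment> \<open>Here \<open>c 0\<close> is 0 because of the division by zero, so the integrated
    series has no constant term.\<close>
  define c where "c n = arcsin_coeff (n - 1) / real n" for n
  have c: "\<bar>c n\<bar> \<le> 2" for n
    using arcsin_coeff_bounds[of "n - 1"] by (cases n) (auto simp: c_def field_simps)
  have c_Suc: "real (Suc n) * c (Suc n) = arcsin_coeff n" for n
    by (simp add: c_def)
  let ?f = "\<lambda>t. (\<Sum>n. c n * ((sin t)\<^sup>2) ^ n) - 2 * t\<^sup>2"
  have "(?f has_real_derivative 0) (at u)" if "u \<in> {-(pi/2)<..<pi/2}" for u
  proof -
    have u: "\<bar>u\<bar> < pi / 2"
      using that by auto
    from DERIV_sin_squared_series[of c 2, OF c u]
    have "((\<lambda>t. \<Sum>n. c n * ((sin t)\<^sup>2) ^ n) has_real_derivative 2 * (2 * u)) (at u)"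
      unfolding c_Suc by (simp add: sin_cos_arcsin_series[OF u])
    moreover have "((\<lambda>t. 2 * t\<^sup>2) has_real_derivative 2 * (2 * u)) (at u)"
      by (auto intro!: derivative_eq_intros)
    ultimately show ?thesis
      using DERIV_diff by fastforce
  qed
  then have "?f t = ?f 0"
    using t by (intro DERIV_isconst3[of "-(pi/2)" "pi/2"]) auto
  moreover have "(\<Sum>n. c n * 0 ^ n) = 0"
    using powser_zero[of c] by (simp add: c_def)
  ultimately have eq: "(\<Sum>n. c n * ((sin t)\<^sup>2) ^ n) = 2 * t\<^sup>2"
    by simp
  have "(\<lambda>n. c n * ((sin t)\<^sup>2) ^ n) sums (2 * t\<^sup>2)"
    using summable_sums[OF summable_bounded_coeffs[of c 2, OF c sin_squared_less_1[OF t]]] eq by simp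
  then have "(\<lambda>n. c (Suc n) * ((sin t)\<^sup>2) ^ Suc n) sums (2 * t\<^sup>2)"
    by (subst sums_Suc_iff) (simp add: c_def)
  then have "(\<Sum>n. c (Suc n) * ((sin t)\<^sup>2) ^ Suc n) = 2 * t\<^sup>2"
    by (rule sums_unique[symmetric])
  moreover have "(\<Sum>n. c (Suc n) * ((sin t)\<^sup>2) ^ Suc n)
      = (sin t)\<^sup>2 * (\<Sum>n. c (Suc n) * ((sin t)\<^sup>2) ^ n)"
    by (subst suminf_mult[symmetric])
       (use summable_bounded_coeffs[of "\<lambda>n. c (Suc n)", OF c sin_squared_less_1[OF t]] in \<open>simp_all add: mult_ac\<close>)
  ultimately show ?thesis
    by (simp add: c_def)
qed

text \<open>Write a_n for \<open>arcsin_coeff n\<close>. The recurrence for a_n cancels the harmonic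
  numbers and leaves 2 a_n - a_n / (2(n+1)) - 2 a_{n-1}. The three parts are summed by the arcsin
  and arcsin^2 series.\<close>

lemma DERIV_sin_cos_arcsin_harm_series:
  assumes t: "0 < t" "t < pi / 2"
  shows "((\<lambda>t. sin t * cos t * (\<Sum>n. arcsin_harm_coeff n * ((sin t)\<^sup>2) ^ n)) has_real_derivative
           4 * t * cot t - t\<^sup>2 / (sin t)\<^sup>2) (at t)"
proof (rule DERIV_sin_cos_series[where M = 4])
  define w where "w = (sin t)\<^sup>2"
  have t': "\<bar>t\<bar> < pi / 2" and w: "\<bar>w\<bar> < 1"
    using t sin_squared_less_1[of t] by (auto simp: w_def)
  have sin: "sin t > 0" and cos: "cos t > 0"
    using t by (auto intro!: sin_gt_zero cos_gt_zero)
  define B where "B = 2 * t / (sin t * cos t)"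
  have "summable (\<lambda>n. arcsin_coeff n * w ^ n)"
    using arcsin_coeff_bounds w by (intro summable_bounded_coeffs[where M = 2]) (simp_all add: abs_of_pos)
  moreover have "(\<Sum>n. arcsin_coeff n * w ^ n) = B"
    using sin_cos_arcsin_series[OF t'] sin cos by (simp add: w_def B_def field_simps)
  ultimately have B: "(\<lambda>n. arcsin_coeff n * w ^ n) sums B"
    using summable_sums by metis
  have "\<bar>arcsin_coeff n / real (Suc n)\<bar> \<le> 2" for n
    using arcsin_coeff_bounds[of n] by (simp add: field_simps)
  then have "summable (\<lambda>n. arcsin_coeff n / real (Suc n) * w ^ n)"
    using w by (rule summable_bounded_coeffs)
  moreover have "(\<Sum>n. arcsin_coeff n / real (Suc n) * w ^ n) = 2 * t\<^sup>2 / w"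
    using arcsin_squared_series[OF t'] sin by (simp add: w_def field_simps)
  ultimately have E: "(\<lambda>n. arcsin_coeff n / real (Suc n) * w ^ n) sums (2 * t\<^sup>2 / w)"
    using summable_sums by metis
  have "(\<lambda>n. arcsin_coeff (Suc n - 1) * w ^ Suc n) sums (w * B)"
    using sums_mult[OF B, of w] by (simp add: mult_ac)
  \<comment> \<open>No factor n multiplies the shifted coefficient this time, so the case
    distinction has to suppress the truncated index at n = 0.\<close>
  then have "(\<lambda>n. if Suc n = 0 then 0 else arcsin_coeff (Suc n - 1) * w ^ Suc n) sums (w * B)"
    by simp
  then have B': "(\<lambda>n. if n = 0 then 0 else arcsin_coeff (n - 1) * w ^ n) sums (w * B)"
    by (subst (asm) sums_Suc_iff) simp
  have "(\<lambda>n. 2 * (arcsin_coeff n * w ^ n) - 1 / 2 * (arcsin_coeff n / real (Suc n) * w ^ n)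
          - 2 * (if n = 0 then 0 else arcsin_coeff (n - 1) * w ^ n))
        sums (2 * B - 1 / 2 * (2 * t\<^sup>2 / w) - 2 * (w * B))"
    by (intro sums_diff sums_mult B B' E)
  moreover have coeff: "2 * (arcsin_coeff n * w ^ n) - 1 / 2 * (arcsin_coeff n / real (Suc n) * w ^ n)
          - 2 * (if n = 0 then 0 else arcsin_coeff (n - 1) * w ^ n) =
        (real (2 * n + 1) * arcsin_harm_coeff n - real (2 * n) * arcsin_harm_coeff (n - 1)) * w ^ n" for n
  proof (cases n)
    case 0
    then show ?thesis
      by (simp add: arcsin_harm_coeff_def arcsin_coeff_0 harm_expand)
  next
    case (Suc m)
    define h where "h = harm (2 * Suc m) - (harm m :: real)"
    define b where "b = arcsin_coeff (Suc m)"
    define a where "a = arcsin_coeff m"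
    define K where "K = real (2 * Suc m + 1)"
    define p where "p = 1 / real (2 * Suc m + 1)"
    define q where "q = 1 / real (2 * Suc m + 2)"
    define s where "s = 1 / real (Suc m)"
    have Kb: "K * b = real (2 * Suc m) * a"
      unfolding K_def a_def b_def by (rule arcsin_coeff_Suc)
    have "real (2 * Suc m) * s = 2"
      by (simp add: s_def field_simps)
    then have Kbs: "K * b * s = 2 * a"
      unfolding Kb by (metis mult.assoc mult.commute)
    have Kp: "K * p = 1"
      by (simp add: K_def p_def)
    have Kq: "K * q = 1 - 1 / 2 * (1 / real (Suc n))"
      by (simp add: K_def q_def Suc field_simps)
    \<comment> \<open>The harmonic difference h is multiplied by K b - 2(m+1) a, which is 0 by
      \<open>Kb\<close>; only the increments p, q and s of the harmonic difference remain.\<close>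
    have "K * (b * (h + p + q - s)) - real (2 * Suc m) * (a * h)
        = (K * b - real (2 * Suc m) * a) * h + b * (K * p) + b * (K * q) - K * b * s"
      by (simp add: algebra_simps)
    also have "\<dots> = 2 * b - 1 / 2 * (b / real (Suc n)) - 2 * a"
      unfolding Kbs Kp Kq unfolding Kb by (simp add: right_diff_distrib)
    finally have "2 * b - 1 / 2 * (b / real (Suc n)) - 2 * a
        = K * arcsin_harm_coeff n - real (2 * Suc m) * arcsin_harm_coeff m"
      by (simp only: arcsin_harm_coeff_def Suc harm_diff_Suc h_def a_def b_def p_def q_def s_def)
    from arg_cong[OF this, of "\<lambda>x. x * w ^ n"] show ?thesis
      by (simp add: Suc a_def b_def K_def left_diff_distrib)
  qed
  moreover have limit: "2 * B - 1 / 2 * (2 * t\<^sup>2 / w) - 2 * (w * B) = 4 * t * cot t - t\<^sup>2 / w"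
  proof -
    have "2 * B - 2 * (w * B) = 2 * (cos t)\<^sup>2 * B"
      by (simp add: w_def cos_squared_eq algebra_simps)
    also have "\<dots> = 4 * t * cot t"
      using sin cos by (simp add: B_def cot_def power2_eq_square)
    finally show ?thesis by simp
  qed
  ultimately show "(\<lambda>n. (real (2 * n + 1) * arcsin_harm_coeff n - real (2 * n) * arcsin_harm_coeff (n - 1))
      * ((sin t)\<^sup>2) ^ n) sums (4 * t * cot t - t\<^sup>2 / (sin t)\<^sup>2)"
    unfolding coeff limit by (simp only: w_def)
qed (use t arcsin_harm_coeff_bounded in simp_all)

section \<open>Clausen-type series\<close>

text \<open>In both series the summand for \<open>n = 0\<close> is \<open>0\<close>, because \<open>x / 0 = 0\<close>.\<close>

definition clausen_sin :: "real \<Rightarrow> real" where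
  "clausen_sin y = (\<Sum>n. sin (real n * y) / real n ^ 2)"

definition clausen_cos :: "real \<Rightarrow> real" where
  "clausen_cos y = (\<Sum>n. cos (real n * y) / real n ^ 3)"

lemma summable_inverse_square: "summable (\<lambda>n. 1 / real n ^ 2)"
  using inverse_power_summable[of 2, where ?'a = real] by (simp add: inverse_eq_divide)

lemma summable_clausen_cos: "summable (\<lambda>n. cos (real n * y) / real n ^ 3)"
proof (rule summable_comparison_test')
  show "summable (\<lambda>n. 1 / real n ^ 3)"
    using inverse_power_summable[of 3, where ?'a = real] by (simp add: inverse_eq_divide)
  show "norm (cos (real n * y) / real n ^ 3) \<le> 1 / real n ^ 3" for n
    by (auto intro!: divide_right_mono)
qed

lemma clausen_sin_bound: "norm (sin (real n * y) / real n ^ 2) \<le> 1 / real n ^ 2"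
  by (auto intro!: divide_right_mono)

text \<open>Provides the limit at 0, where the derivative of \<open>clausen_sin\<close> found below
  has a logarithmic singularity.\<close>

lemma continuous_on_clausen_sin: "continuous_on UNIV clausen_sin"
proof (rule uniform_limit_theorem)
  have "uniformly_convergent_on UNIV (\<lambda>n y. \<Sum>k<n. sin (real k * y) / real k ^ 2)"
    by (rule Weierstrass_m_test'[OF clausen_sin_bound summable_inverse_square])
  then show "uniform_limit UNIV (\<lambda>n y. \<Sum>k<n. sin (real k * y) / real k ^ 2) clausen_sin sequentially"
    unfolding clausen_sin_def[abs_def] by (rule uniform_limit_suminf)
  have "continuous_on UNIV (\<lambda>y. sin (real k * y) / real k ^ 2)" for k
    by (cases "k = 0") (auto intro!: continuous_intros)
  then show "\<forall>\<^sub>F n in sequentially. continuous_on UNIV (\<lambda>y. \<Sum>k<n. sin (real k * y) / real k ^ 2)"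
    by (intro always_eventually allI continuous_on_sum)
qed simp

lemma DERIV_clausen_cos: "(clausen_cos has_real_derivative - clausen_sin y) (at y)"
proof -
  have "((\<lambda>y. \<Sum>n. cos (real n * y) / real n ^ 3) has_real_derivative
          (\<Sum>n. - (sin (real n * y) / real n ^ 2))) (at y)"
  proof (rule has_field_derivative_series'(2)[of UNIV _ _ 0])
    show "((\<lambda>y. cos (real n * y) / real n ^ 3) has_real_derivative - (sin (real n * y) / real n ^ 2))
            (at y within UNIV)" for n y
      by (cases "n = 0") (auto intro!: derivative_eq_intros simp: field_simps power2_eq_square power3_eq_cube)
    show "uniformly_convergent_on UNIV (\<lambda>n y. \<Sum>k<n. - (sin (real k * y) / real k ^ 2))"
      by (rule Weierstrass_m_test'[OF _ summable_inverse_square]) (use clausen_sin_bound in simp)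
  qed (use summable_clausen_cos[of 0] in auto)
  moreover have "summable (\<lambda>n. sin (real n * y) / real n ^ 2)"
    by (rule summable_comparison_test'[OF summable_inverse_square clausen_sin_bound])
  ultimately show ?thesis
    by (simp add: clausen_cos_def[abs_def] clausen_sin_def suminf_minus)
qed

section \<open>Abel summation and the derivative of \<open>clausen_sin\<close>\<close>

lemma cos_log_series:
  assumes r: "0 \<le> r" "r < 1"
  shows "(\<lambda>n. r ^ n * cos (real n * y) / real n) sums (- ln (1 - 2 * r * cos y + r\<^sup>2) / 2)"
proof -
  \<comment> \<open>The series is the real part of - ln(1 - z), and |1 - z|^2 = 1 - 2 r cos y +
    r^2.\<close>
  define z where "z = of_real r * cis y"
  have "cmod z < 1"
    using r by (simp add: z_def norm_mult)
  then have "z \<noteq> 1"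
    by auto
  have "(\<lambda>n. - (z ^ n / of_nat n)) sums ln (1 - z)"
    using Ln_series'[of "- z"] \<open>cmod z < 1\<close> by simp
  from sums_minus[OF sums_Re[OF this]] have "(\<lambda>n. Re (z ^ n / of_nat n)) sums - Re (ln (1 - z))"
    by simp
  moreover have "Re (z ^ n / of_nat n) = r ^ n * cos (real n * y) / real n" for n
    by (simp add: z_def power_mult_distrib Complex.DeMoivre flip: of_real_power)
  moreover have "Re (ln (1 - z)) = ln (1 - 2 * r * cos y + r\<^sup>2) / 2"
  proof -
    have "Re (ln (1 - z)) = ln (sqrt ((1 - r * cos y)\<^sup>2 + (r * sin y)\<^sup>2))"
      using \<open>z \<noteq> 1\<close> by (simp add: z_def cmod_def)
    also have "(1 - r * cos y)\<^sup>2 + (r * sin y)\<^sup>2 = 1 - 2 * r * cos y + r\<^sup>2 * ((sin y)\<^sup>2 + (cos y)\<^sup>2)"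
      by algebra
    also have "\<dots> = 1 - 2 * r * cos y + r\<^sup>2"
      by simp
    also have "ln (sqrt (1 - 2 * r * cos y + r\<^sup>2)) = ln (1 - 2 * r * cos y + r\<^sup>2) / 2"
    proof (rule ln_sqrt)
      have "0 < (1 - r)\<^sup>2"
        using r by simp
      also have "\<dots> = 1 - 2 * r * 1 + r\<^sup>2"
        by (simp add: power2_eq_square algebra_simps)
      also have "\<dots> \<le> 1 - 2 * r * cos y + r\<^sup>2"
        using r mult_left_mono[of "cos y" 1 "2 * r"] by simp
      finally show "0 \<le> 1 - 2 * r * cos y + r\<^sup>2"
        by (rule less_imp_le)
    qed
    finally show ?thesis .
  qed
  ultimately show ?thesis
    by (simp only: minus_divide_left)
qed

text \<open>The damping factor r^n makes the differentiated series uniformly convergent by a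
  geometric majorant; undamped, its terms are only bounded by 1/n.\<close>

lemma DERIV_abel_clausen_sin:
  assumes r: "0 \<le> r" "r < 1"
  shows "((\<lambda>y. \<Sum>n. r ^ n * sin (real n * y) / real n ^ 2) has_real_derivative
           - ln (1 - 2 * r * cos y + r\<^sup>2) / 2) (at y)"
proof -
  have "((\<lambda>y. \<Sum>n. r ^ n * sin (real n * y) / real n ^ 2) has_real_derivative
          (\<Sum>n. r ^ n * cos (real n * y) / real n)) (at y)"
  proof (rule has_field_derivative_series'(2)[of UNIV _ _ 0])
    show "((\<lambda>y. r ^ n * sin (real n * y) / real n ^ 2) has_real_derivative r ^ n * cos (real n * y) / real n)
            (at y within UNIV)" for n y
      by (cases "n = 0") (auto intro!: derivative_eq_intros simp: field_simps power2_eq_square)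
    show "uniformly_convergent_on UNIV (\<lambda>n y. \<Sum>k<n. r ^ k * cos (real k * y) / real k)"
    proof (rule Weierstrass_m_test')
      show "summable (\<lambda>n. r ^ n)"
        using r by (intro summable_geometric) simp
      show "norm (r ^ n * cos (real n * y) / real n) \<le> r ^ n" for n y
      proof (cases "n = 0")
        case False
        have "norm (r ^ n * cos (real n * y) / real n) = r ^ n * (\<bar>cos (real n * y)\<bar> / real n)"
          using r by (simp add: abs_mult)
        also have "\<bar>cos (real n * y)\<bar> / real n \<le> 1"
          using False abs_cos_le_one[of "real n * y"] by (simp add: divide_le_eq_1 order_trans[OF abs_cos_le_one])
        finally show ?thesis
          using r by (simp add: mult_left_mono)
      qed simp
    qed
  qed auto
  then show ?thesis
    using sums_unique[OF cos_log_series[OF r, of y]] by simp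
qed

text \<open>Tannery's theorem applies because the damped terms stay below 1/k^2 independently of the
  damping.\<close>

lemma abel_clausen_sin_tendsto:
  assumes r: "\<And>n. 0 \<le> r n" "\<And>n. r n < 1" and lim: "r \<longlonglongrightarrow> 1"
  shows "(\<lambda>n. \<Sum>k. r n ^ k * sin (real k * y) / real k ^ 2) \<longlonglongrightarrow> clausen_sin y"
proof -
  have "(\<lambda>n. r n ^ k * sin (real k * y) / real k ^ 2) \<longlonglongrightarrow> sin (real k * y) / real k ^ 2" for k
    using tendsto_mult_right[OF tendsto_power[OF lim, of k], of "sin (real k * y) / real k ^ 2"] by simp
  moreover have "norm (r n ^ k * sin (real k * y) / real k ^ 2) \<le> 1 / real k ^ 2" for n k
  proof -
    have "norm (r n ^ k * sin (real k * y) / real k ^ 2) = r n ^ k * norm (sin (real k * y) / real k ^ 2)"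
      using r(1)[of n] by (simp add: abs_mult)
    also have "\<dots> \<le> 1 * (1 / real k ^ 2)"
      using r(1)[of n] r(2)[of n] by (intro mult_mono clausen_sin_bound power_le_one) auto
    finally show ?thesis by simp
  qed
  ultimately show ?thesis
    unfolding clausen_sin_def
    using tannerys_theorem[of "\<lambda>k n. r n ^ k * sin (real k * y) / real k ^ 2"
        "\<lambda>k. sin (real k * y) / real k ^ 2" sequentially "\<lambda>k. 1 / real k ^ 2", OF _ _ summable_inverse_square]
    by (simp add: always_eventually)
qed

lemma ln_diff_bound:
  fixes x y :: real
  assumes "0 < c" "c \<le> x" "c \<le> y"
  shows "\<bar>ln x - ln y\<bar> \<le> \<bar>x - y\<bar> / c"
proof -
  have *: "ln u - ln v \<le> \<bar>u - v\<bar> / c" if "c \<le> u" "c \<le> v" for u v :: real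
  proof -
    have "ln u - ln v \<le> (u - v) / v"
      using that assms(1) by (intro ln_diff_le) auto
    also have "\<dots> \<le> \<bar>u - v\<bar> / c"
      using that assms(1) by (intro frac_le) auto
    finally show ?thesis .
  qed
  show ?thesis
    using *[of x y] *[of y x] assms(2,3) by (simp add: abs_le_iff abs_minus_commute)
qed

lemma two_minus_two_cos: "2 - 2 * cos (2 * t) = 4 * (sin t)\<^sup>2" for t :: real
  by (simp add: cos_double_sin)

text \<open>The Abel means converge to \<open>clausen_sin\<close>, and their derivatives converge
  uniformly near y to the logarithm; hence the limit may be differentiated.\<close>

lemma DERIV_clausen_sin:
  assumes y: "0 < y" "y < 2 * pi"
  shows "(clausen_sin has_real_derivative - ln (2 - 2 * cos y) / 2) (at y)"
proof -
  \<comment> \<open>The closed interval from a to b contains y and avoids 0 and 2 pi, so 2 - 2 cos u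
    has a positive minimum c on it.\<close>
  define a where "a = y / 2"
  define b where "b = (y + 2 * pi) / 2"
  have ab: "0 < a" "a < y" "y < b" "b < 2 * pi"
    using y by (auto simp: a_def b_def)
  have pos: "0 < 2 - 2 * cos u" if "0 < u" "u < 2 * pi" for u :: real
    using sin_gt_zero[of "u / 2"] two_minus_two_cos[of "u / 2"] that by simp
  have "\<exists>u\<in>{a..b}. \<forall>v\<in>{a..b}. 2 - 2 * cos u \<le> 2 - 2 * cos v"
    using ab by (intro continuous_attains_inf continuous_intros) auto
  then obtain u0 where u0: "u0 \<in> {a..b}" "\<And>v. v \<in> {a..b} \<Longrightarrow> 2 - 2 * cos u0 \<le> 2 - 2 * cos v"
    by blast
  define c where "c = 2 - 2 * cos u0"
  have "c > 0"
    unfolding c_def using u0(1) ab by (intro pos) auto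
  \<comment> \<open>Starting at 1/2 keeps the arguments of all logarithms above c/2.\<close>
  define r where "r n = 1 - 1 / real (n + 2)" for n
  have r: "1 / 2 \<le> r n" "r n < 1" for n
    by (auto simp: r_def field_simps)
  have r0: "0 \<le> r n" for n
    using r(1)[of n] by simp
  have "(\<lambda>n. 1 / real (n + 2)) \<longlonglongrightarrow> 0"
    by (rule LIMSEQ_ignore_initial_segment) (rule lim_1_over_n)
  from tendsto_diff[OF tendsto_const this, of 1] have r_lim: "r \<longlonglongrightarrow> 1"
    by (simp add: r_def[abs_def])
  \<comment> \<open>With B = 2 - 2 cos u the two arguments are (1-r)^2 + r B and B. They differ by
    (1-r)(1-r-B), where |1-r-B| is at most 5, and ln has Lipschitz constant 2/c above c/2.\<close>
  have log_diff: "\<bar>ln (1 - 2 * r n * cos u + (r n)\<^sup>2) - ln (2 - 2 * cos u)\<bar> / 2 \<le> 5 * (1 - r n) / c"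
    if u: "u \<in> {a<..<b}" for n u
  proof -
    define B where "B = 2 - 2 * cos u"
    have B: "c \<le> B" "B \<le> 4"
      using u0(2)[of u] u cos_ge_minus_one[of u] unfolding c_def B_def by (simp, linarith)
    have A: "1 - 2 * r n * cos u + (r n)\<^sup>2 = (1 - r n)\<^sup>2 + r n * B"
      by (simp add: B_def power2_eq_square algebra_simps)
    have "1 / 2 * c \<le> r n * B"
      using r(1)[of n] B \<open>c > 0\<close> by (intro mult_mono) auto
    then have "\<bar>ln ((1 - r n)\<^sup>2 + r n * B) - ln B\<bar> \<le> \<bar>(1 - r n)\<^sup>2 + r n * B - B\<bar> / (c / 2)"
      using B \<open>c > 0\<close> zero_le_power2[of "1 - r n"] by (intro ln_diff_bound) linarith+
    also have "(1 - r n)\<^sup>2 + r n * B - B = (1 - r n) * (1 - r n - B)"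
      by (simp add: power2_eq_square algebra_simps)
    also have "\<bar>(1 - r n) * (1 - r n - B)\<bar> \<le> (1 - r n) * 5"
      unfolding abs_mult using r[of n] B \<open>c > 0\<close> by (intro mult_mono) auto
    then have "\<bar>(1 - r n) * (1 - r n - B)\<bar> / (c / 2) \<le> (1 - r n) * 5 / (c / 2)"
      using \<open>c > 0\<close> by (intro divide_right_mono) auto
    also have "(1 - r n) * 5 / (c / 2) = 5 * (1 - r n) / c * 2"
      by simp
    finally show ?thesis
      unfolding A B_def by (subst divide_le_eq) simp
  qed
  have deriv: "((\<lambda>u. \<Sum>k. r n ^ k * sin (real k * u) / real k ^ 2) has_derivative
          (\<lambda>h. - ln (1 - 2 * r n * cos u + (r n)\<^sup>2) / 2 * h)) (at u within {a<..<b})" for n u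
    using DERIV_abel_clausen_sin[OF r0[of n] r(2)[of n], of u]
    unfolding has_field_derivative_def by (rule has_derivative_at_withinI)
  have uniform: "\<forall>\<^sub>F n in sequentially. \<forall>u\<in>{a<..<b}. \<forall>h.
          norm (- ln (1 - 2 * r n * cos u + (r n)\<^sup>2) / 2 * h - - ln (2 - 2 * cos u) / 2 * h) \<le> e * norm h"
    if "e > 0" for e
  proof -
    have "(\<lambda>n. 5 * (1 - r n) / c) \<longlonglongrightarrow> 5 * (1 - 1) / c"
      using \<open>c > 0\<close> by (intro tendsto_intros r_lim) auto
    then have "\<forall>\<^sub>F n in sequentially. 5 * (1 - r n) / c < e"
      using that by (intro order_tendstoD(2)[where y = "5 * (1 - 1) / c"]) auto
    then show ?thesis
    proof eventually_elim
      case (elim n)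
      show ?case
      proof (intro ballI allI)
        fix u h assume u: "u \<in> {a<..<b}"
        let ?d = "ln (1 - 2 * r n * cos u + (r n)\<^sup>2) - ln (2 - 2 * cos u)"
        have "norm (- ln (1 - 2 * r n * cos u + (r n)\<^sup>2) / 2 * h - - ln (2 - 2 * cos u) / 2 * h)
              = \<bar>?d\<bar> / 2 * \<bar>h\<bar>"
        proof -
          have "- ln (1 - 2 * r n * cos u + (r n)\<^sup>2) / 2 * h - - ln (2 - 2 * cos u) / 2 * h = - (?d / 2 * h)"
            by (simp add: field_simps)
          then show ?thesis
            by (simp add: abs_mult)
        qed
        also have "\<dots> \<le> e * \<bar>h\<bar>"
          using elim by (intro mult_right_mono order_trans[OF log_diff[OF u]]) auto
        finally show "norm (- ln (1 - 2 * r n * cos u + (r n)\<^sup>2) / 2 * h - - ln (2 - 2 * cos u) / 2 * h)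
              \<le> e * norm h" by simp
      qed
    qed
  qed
  have lim: "(\<lambda>n. \<Sum>k. r n ^ k * sin (real k * y) / real k ^ 2) \<longlonglongrightarrow> clausen_sin y"
    by (intro abel_clausen_sin_tendsto r0 r r_lim)
  have "convex {a<..<b}" and y_in: "y \<in> {a<..<b}"
    using ab by auto
  from has_derivative_sequence[OF this(1) deriv uniform y_in lim]
  obtain g where g: "\<And>u. u \<in> {a<..<b} \<Longrightarrow>
        (\<lambda>n. \<Sum>k. r n ^ k * sin (real k * u) / real k ^ 2) \<longlonglongrightarrow> g u"
      and g': "\<And>u. u \<in> {a<..<b} \<Longrightarrow>
        (g has_derivative (\<lambda>h. - ln (2 - 2 * cos u) / 2 * h)) (at u within {a<..<b})"
    by blast
  \<comment> \<open>The limit function obtained is anonymous; it must agree with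
    \<open>clausen_sin\<close> on the whole open interval before its derivative can be
    transferred.\<close>
  have "g u = clausen_sin u" if "u \<in> {a<..<b}" for u
    using LIMSEQ_unique[OF g[OF that] abel_clausen_sin_tendsto[OF r0 r(2) r_lim]] .
  moreover have "(g has_derivative (\<lambda>h. - ln (2 - 2 * cos y) / 2 * h)) (at y)"
    using g'[OF y_in] at_within_open[OF y_in] by simp
  ultimately have "(clausen_sin has_derivative (\<lambda>h. - ln (2 - 2 * cos y) / 2 * h)) (at y)"
    using has_derivative_transform_within_open[of g _ y UNIV "{a<..<b}" clausen_sin] y_in by simp
  then show ?thesis
    unfolding has_field_derivative_def .
qed

section \<open>The distribution relation for \<open>clausen_cos\<close>\<close>

lemma sum_cos_equidistant:
  fixes m n :: nat
  assumes m: "m > 0"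
  shows "(\<Sum>j<m. cos (real n * (y + 2 * pi * real j / real m))) =
           (if m dvd n then real m * cos (real n * y) else 0)"
proof -
  \<comment> \<open>The sum is the real part of a geometric sum with ratio w, an m-th root of unity
    that equals 1 exactly when m divides n.\<close>
  define w where "w = cis (2 * pi * real n / real m)"
  have "cis (real n * (y + 2 * pi * real j / real m)) = cis (real n * y) * w ^ j" for j
    unfolding w_def Complex.DeMoivre cis_mult by (simp add: algebra_simps)
  then have eq: "(\<Sum>j<m. cis (real n * (y + 2 * pi * real j / real m))) = cis (real n * y) * (\<Sum>j<m. w ^ j)"
    by (simp add: sum_distrib_left)
  have "(\<Sum>j<m. w ^ j) = (if m dvd n then of_nat m else 0)"
  proof (cases "m dvd n")
    case True
    then obtain k where "n = m * k" ..
    then have "2 * pi * real n / real m = 2 * pi * real k"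
      using m by simp
    then have "w = 1"
      unfolding w_def by (metis cis_multiple_2pi Nats_subset_Ints of_nat_in_Nats subsetD)
    then show ?thesis
      using True by simp
  next
    case False
    have "w \<noteq> 1"
    proof
      assume "w = 1"
      then have "cos (2 * pi * real n / real m) = 1"
        by (metis w_def cis.sel(1) one_complex.sel(1))
      then obtain i :: int where "2 * pi * real n / real m = of_int i * 2 * pi"
        by (auto simp: cos_one_2pi_int)
      then have "real n = of_int i * real m"
        using m by (simp add: field_simps)
      then have "int n = i * int m"
        by (metis of_int_eq_iff of_int_mult of_int_of_nat_eq)
      then show False
        using False by (metis dvd_triv_right int_dvd_int_iff)
    qed
    moreover have "w ^ m = 1"
      using m by (simp add: w_def Complex.DeMoivre)
    ultimately show ?thesis
      using False by (simp add: geometric_sum)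
  qed
  with arg_cong[OF eq, of Re] show ?thesis
    by simp
qed

text \<open>Summing over the shifts keeps only the frequencies n = m k, each with weight m / (m k)^3
  = (1 / m^2) (1 / k^3).\<close>

lemma clausen_cos_distribution:
  assumes m: "m > 0"
  shows "(\<Sum>j<m. clausen_cos (y + 2 * pi * real j / real m)) = clausen_cos (real m * y) / real m ^ 2"
proof -
  let ?f = "\<lambda>n. (if m dvd n then real m * cos (real n * y) else 0) / real n ^ 3"
  have "(\<lambda>n. \<Sum>j<m. cos (real n * (y + 2 * pi * real j / real m)) / real n ^ 3) sums
          (\<Sum>j<m. clausen_cos (y + 2 * pi * real j / real m))"
    unfolding clausen_cos_def by (intro sums_sum summable_sums summable_clausen_cos)
  then have "?f sums (\<Sum>j<m. clausen_cos (y + 2 * pi * real j / real m))"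
    by (simp add: sum_cos_equidistant[OF m] flip: sum_divide_distrib)
  moreover have "(\<lambda>k. ?f (m * k)) sums c \<longleftrightarrow> ?f sums c" for c
    by (rule sums_mono_reindex) (use m in \<open>auto simp: strict_mono_def elim!: dvdE\<close>)
  moreover have "(\<lambda>k. cos (real k * (real m * y)) / real k ^ 3 / real m ^ 2) sums
      (clausen_cos (real m * y) / real m ^ 2)"
    unfolding clausen_cos_def by (intro sums_divide summable_sums summable_clausen_cos)
  moreover have "cos (real k * (real m * y)) / real k ^ 3 / real m ^ 2 = ?f (m * k)" for k
    using m by (simp add: field_simps power2_eq_square power3_eq_cube)
  ultimately show ?thesis
    by (simp add: sums_unique2)
qed

section \<open>The generating function and its special values\<close>

lemma t_ln_sin_tendsto_0: "((\<lambda>t::real. t * ln (4 * (sin t)\<^sup>2)) \<longlongrightarrow> 0) (at_right 0)"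
  by real_asymp

lemma t_sq_cot_tendsto_0: "((\<lambda>t::real. t\<^sup>2 * cot t) \<longlongrightarrow> 0) (at_right 0)"
  unfolding cot_def by real_asymp

lemma t_sq_ln_sin_tendsto_0: "((\<lambda>t::real. t\<^sup>2 * ln (4 * (sin t)\<^sup>2)) \<longlongrightarrow> 0) (at_right 0)"
  by real_asymp

text \<open>The closed forms contain ln(4 sin^2 t) and cot t, which are singular at 0, so the
  initial condition is a one-sided limit.\<close>

lemma DERIV_0_tendsto_0_imp_eq_0:
  fixes f :: "real \<Rightarrow> real"
  assumes f': "\<And>x. a < x \<Longrightarrow> x < b \<Longrightarrow> (f has_real_derivative 0) (at x)"
    and lim: "(f \<longlongrightarrow> 0) (at_right a)" and x: "a < x" "x < b"
  shows "f x = 0"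
proof -
  have "\<forall>\<^sub>F y in at_right a. f y = f x"
  proof -
    have "\<forall>\<^sub>F y in at_right a. y \<in> {a<..<b}"
      using x by (intro eventually_at_right_real) auto
    then show ?thesis
      by eventually_elim (rule DERIV_isconst3[of a b], use x f' in auto)
  qed
  then have "(f \<longlongrightarrow> f x) (at_right a)"
    by (rule tendsto_eventually)
  then show ?thesis
    using lim by (intro tendsto_unique) auto
qed

text \<open>Both sides have derivative 4 t cot t - t^2 / sin^2 t and tend to 0. On the right, the
  logarithm from \<open>clausen_sin (2 * t)\<close> cancels the one from differentiating the factor
  t of t ln(4 sin^2 t).\<close>

lemma sin_cos_arcsin_harm_series:
  assumes t: "0 < t" "t < pi / 2"
  shows "sin t * cos t * (\<Sum>n. arcsin_harm_coeff n * ((sin t)\<^sup>2) ^ n) =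
           clausen_sin (2 * t) + t * ln (4 * (sin t)\<^sup>2) + t\<^sup>2 * cot t"
proof -
  let ?q = "\<lambda>t. sin t * cos t * (\<Sum>n. arcsin_harm_coeff n * ((sin t)\<^sup>2) ^ n)"
  let ?f = "\<lambda>t. ?q t - (clausen_sin (2 * t) + t * ln (4 * (sin t)\<^sup>2) + t\<^sup>2 * cot t)"
  have "?f t = 0"
  proof (rule DERIV_0_tendsto_0_imp_eq_0[of 0 "pi / 2" ?f t])
    fix u :: real assume u: "0 < u" "u < pi / 2"
    have sin: "sin u > 0"
      using u by (intro sin_gt_zero) auto
    have "(clausen_sin has_real_derivative - ln (2 - 2 * cos (2 * u)) / 2) (at (2 * u))"
      using u by (intro DERIV_clausen_sin) auto
    then have "((\<lambda>u. clausen_sin (2 * u)) has_real_derivative - ln (4 * (sin u)\<^sup>2) / 2 * 2) (at u)"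
      unfolding two_minus_two_cos by (rule DERIV_chain2) (auto intro!: derivative_eq_intros)
    moreover have "((\<lambda>u. u * ln (4 * (sin u)\<^sup>2)) has_real_derivative ln (4 * (sin u)\<^sup>2) + 2 * u * cot u) (at u)"
      using sin by (auto intro!: derivative_eq_intros simp: cot_def field_simps power2_eq_square)
    moreover have "((\<lambda>u. u\<^sup>2 * cot u) has_real_derivative 2 * u * cot u - u\<^sup>2 / (sin u)\<^sup>2) (at u)"
      using sin by (auto intro!: derivative_eq_intros DERIV_cot[THEN DERIV_cong] simp: field_simps)
    ultimately have "(?f has_real_derivative (4 * u * cot u - u\<^sup>2 / (sin u)\<^sup>2)
         - (- ln (4 * (sin u)\<^sup>2) / 2 * 2 + (ln (4 * (sin u)\<^sup>2) + 2 * u * cot u)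
            + (2 * u * cot u - u\<^sup>2 / (sin u)\<^sup>2))) (at u)"
      by (intro DERIV_diff DERIV_add DERIV_sin_cos_arcsin_harm_series u)
    then show "(?f has_real_derivative 0) (at u)"
      by simp
  next
    have "isCont ?q 0"
    proof -
      have "isCont (\<lambda>t. \<Sum>n. arcsin_harm_coeff n * ((sin t)\<^sup>2) ^ n) 0"
        using DERIV_sin_squared_series[of arcsin_harm_coeff 4 0, OF arcsin_harm_coeff_bounded]
        by (intro DERIV_isCont) auto
      then show ?thesis
        by (intro continuous_intros)
    qed
    then have q: "(?q \<longlongrightarrow> 0) (at_right 0)"
      by (auto simp: isCont_def intro: tendsto_within_subset)
    have "((\<lambda>t. clausen_sin (2 * t)) \<longlongrightarrow> clausen_sin (2 * 0)) (at_right 0)"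
      using continuous_on_clausen_sin by (intro continuous_on_tendsto_compose[of UNIV clausen_sin] tendsto_intros) auto
    then have sin: "((\<lambda>t. clausen_sin (2 * t)) \<longlongrightarrow> 0) (at_right 0)"
      by (simp add: clausen_sin_def)
    show "(?f \<longlongrightarrow> 0) (at_right 0)"
      using tendsto_diff[OF q tendsto_add[OF tendsto_add[OF sin t_ln_sin_tendsto_0] t_sq_cot_tendsto_0]]
      by simp
  qed (use t in auto)
  then show ?thesis
    by simp
qed

lemma binomial_harm_term_4_sin_squared:
  "binomial_harm_term (\<lambda>n. (4 * x) ^ n) (Suc k) = arcsin_harm_coeff k / real (Suc k) * x ^ Suc k"
  by (simp add: binomial_harm_term_def arcsin_harm_coeff_def arcsin_coeff_def power_mult_distrib
      power2_eq_square mult_ac del: binomial_Suc_Suc mult_Suc_right)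

text \<open>Integrates the preceding identity once more, since both sides have twice that function
  as derivative; \<open>clausen_cos 0\<close> is the constant that makes the right side tend to
  0.\<close>

lemma binomial_harm_sums:
  assumes t: "0 < t" "t < pi / 2"
  shows "(\<lambda>k. binomial_harm_term (\<lambda>n. (4 * (sin t)\<^sup>2) ^ n) (Suc k)) sums
           (clausen_cos 0 - clausen_cos (2 * t) + t\<^sup>2 * ln (4 * (sin t)\<^sup>2))"
proof -
  \<comment> \<open>Again \<open>c 0\<close> is 0 by the division by zero, so the series starts with
    the summand n = 1.\<close>
  define c where "c n = arcsin_harm_coeff (n - 1) / real n" for n
  have c: "\<bar>c n\<bar> \<le> 4" for n
  proof (cases n)
    case (Suc m)
    have "\<bar>c n\<bar> = \<bar>arcsin_harm_coeff m\<bar> / real n"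
      by (simp add: c_def Suc)
    also have "\<dots> \<le> 4 / 1"
      using arcsin_harm_coeff_bounded[of m] Suc by (intro frac_le) auto
    finally show ?thesis by simp
  qed (simp add: c_def)
  have c_Suc: "real (Suc n) * c (Suc n) = arcsin_harm_coeff n" for n
    by (simp add: c_def)
  let ?G = "\<lambda>t. \<Sum>n. c n * ((sin t)\<^sup>2) ^ n"
  have G': "(?G has_real_derivative 2 * (sin u * cos u * (\<Sum>n. arcsin_harm_coeff n * ((sin u)\<^sup>2) ^ n))) (at u)"
    if "\<bar>u\<bar> < pi / 2" for u
    using DERIV_sin_squared_series[of c 4, OF c that] unfolding c_Suc .
  let ?f = "\<lambda>t. ?G t - (clausen_cos 0 - clausen_cos (2 * t) + t\<^sup>2 * ln (4 * (sin t)\<^sup>2))"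
  have "?f t = 0"
  proof (rule DERIV_0_tendsto_0_imp_eq_0[of 0 "pi / 2" ?f t])
    fix u :: real assume u: "0 < u" "u < pi / 2"
    have sin: "sin u > 0"
      using u by (intro sin_gt_zero) auto
    have cos: "((\<lambda>u. clausen_cos (2 * u)) has_real_derivative - clausen_sin (2 * u) * 2) (at u)"
      by (rule DERIV_chain2[OF DERIV_clausen_cos]) (auto intro!: derivative_eq_intros)
    have ln: "((\<lambda>u. u\<^sup>2 * ln (4 * (sin u)\<^sup>2)) has_real_derivative
        2 * (u * ln (4 * (sin u)\<^sup>2) + u\<^sup>2 * cot u)) (at u)"
      using sin by (auto intro!: derivative_eq_intros simp: cot_def field_simps power2_eq_square)
    have G: "(?G has_real_derivative
        2 * (clausen_sin (2 * u) + u * ln (4 * (sin u)\<^sup>2) + u\<^sup>2 * cot u)) (at u)"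
      using G'[of u] u by (simp add: sin_cos_arcsin_harm_series[OF u])
    have "((\<lambda>u. clausen_cos 0 - clausen_cos (2 * u) + u\<^sup>2 * ln (4 * (sin u)\<^sup>2)) has_real_derivative
        0 - - clausen_sin (2 * u) * 2 + 2 * (u * ln (4 * (sin u)\<^sup>2) + u\<^sup>2 * cot u)) (at u)"
      by (rule DERIV_add[OF DERIV_diff[OF DERIV_const cos] ln])
    from DERIV_diff[OF G this]
    have "(?f has_real_derivative
        2 * (clausen_sin (2 * u) + u * ln (4 * (sin u)\<^sup>2) + u\<^sup>2 * cot u)
         - (0 - - clausen_sin (2 * u) * 2 + 2 * (u * ln (4 * (sin u)\<^sup>2) + u\<^sup>2 * cot u))) (at u)" .
    moreover have "2 * (x + y + z) - (0 - - x * 2 + 2 * (y + z)) = 0" for x y z :: real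
      by simp
    ultimately show "(?f has_real_derivative 0) (at u)"
      by (simp only:)
  next
    have "isCont ?G 0"
      by (rule DERIV_isCont[OF G']) simp
    moreover have "?G 0 = 0"
      using powser_zero[of c] by (simp add: c_def)
    ultimately have "(?G \<longlongrightarrow> 0) (at 0)"
      unfolding isCont_def by (simp only:)
    then have G: "(?G \<longlongrightarrow> 0) (at_right 0)"
      by (rule tendsto_within_subset) simp
    have cos: "((\<lambda>t. clausen_cos (2 * t)) \<longlongrightarrow> clausen_cos (2 * 0)) (at_right 0)"
      by (rule isCont_tendsto_compose[OF DERIV_isCont[OF DERIV_clausen_cos]]) (intro tendsto_intros)
    show "(?f \<longlongrightarrow> 0) (at_right 0)"
      using tendsto_diff[OF G tendsto_add[OF tendsto_diff[OF tendsto_const[of "clausen_cos 0"] cos]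
            t_sq_ln_sin_tendsto_0]] by simp
  qed (use t in auto)
  then have eq: "?G t = clausen_cos 0 - clausen_cos (2 * t) + t\<^sup>2 * ln (4 * (sin t)\<^sup>2)"
    by simp
  have "\<bar>(sin t)\<^sup>2\<bar> < 1"
    using t by (intro sin_squared_less_1) auto
  then have "(\<lambda>n. c n * ((sin t)\<^sup>2) ^ n) sums ?G t"
    by (intro summable_sums summable_bounded_coeffs[of c 4] c)
  then have "(\<lambda>n. c (Suc n) * ((sin t)\<^sup>2) ^ Suc n) sums ?G t"
    by (subst sums_Suc_iff) (simp add: c_def)
  then show ?thesis
    unfolding eq binomial_harm_term_4_sin_squared by (simp add: c_def)
qed

section \<open>Reduction of the four sums to values of \<open>clausen_cos\<close>\<close>

lemma lucas_v_eq_power_sum: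
  fixes \<alpha> \<beta> :: real
  assumes "\<alpha> + \<beta> = of_int A" "\<alpha> * \<beta> = of_int B"
  shows "of_int (lucas_v A B n) = \<alpha> ^ n + \<beta> ^ n"
proof (induction n rule: less_induct)
  case (less n)
  consider "n = 0" | "n = 1" | m where "n = Suc (Suc m)"
    by (metis One_nat_def not0_implies_Suc)
  then show ?case
  proof cases
    case 3
    have "of_int (lucas_v A B n) =
        (\<alpha> + \<beta>) * (\<alpha> ^ Suc m + \<beta> ^ Suc m) - \<alpha> * \<beta> * (\<alpha> ^ m + \<beta> ^ m)"
      using less[of "Suc m"] less[of m] by (simp add: 3 assms del: power_Suc)
    also have "\<dots> = \<alpha> ^ n + \<beta> ^ n"
      by (simp add: 3 algebra_simps)
    finally show ?thesis .
  qed (use assms in auto)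
qed

lemma binomial_harm_term_add:
  "binomial_harm_term (\<lambda>n. a n + b n) k = binomial_harm_term a k + binomial_harm_term b k"
  by (simp add: binomial_harm_term_def add_divide_distrib distrib_right)

lemma zeta_3_eq: "zeta 3 = clausen_cos 0"
proof -
  have "(\<lambda>n. 1 / real n ^ 3) sums clausen_cos 0"
    using summable_sums[OF summable_clausen_cos[of 0]] by (simp add: clausen_cos_def)
  \<comment> \<open>Dropping the term n = 0 changes nothing, as it is 1 / 0 = 0.\<close>
  then have "(\<lambda>n. 1 / real (Suc n) ^ 3) sums clausen_cos 0"
    by (subst sums_Suc_iff) simp
  then have "(\<lambda>n. 1 / real (Suc n) powr 3) sums clausen_cos 0"
    by (simp flip: powr_numeral)
  then show ?thesis
    unfolding zeta_def by (rule sums_unique[symmetric])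
qed

text \<open>Twice the angle is used as parameter because then \<open>x\<^sub>1\<close> and \<open>x\<^sub>2\<close> only involve cosines.\<close>

lemma binomial_harm_power_sum_sums:
  assumes y: "0 < y\<^sub>1" "y\<^sub>1 < pi" "0 < y\<^sub>2" "y\<^sub>2 < pi"
    and x: "x\<^sub>1 = 2 - 2 * cos y\<^sub>1" "x\<^sub>2 = 2 - 2 * cos y\<^sub>2"
    and a: "\<And>n. a n = x\<^sub>1 ^ n + x\<^sub>2 ^ n"
    and C: "clausen_cos y\<^sub>1 + clausen_cos y\<^sub>2 = q * zeta 3"
  shows "(\<lambda>k. binomial_harm_term a (Suc k)) sums
           ((2 - q) * zeta 3 + (y\<^sub>1\<^sup>2 * ln x\<^sub>1 + y\<^sub>2\<^sup>2 * ln x\<^sub>2) / 4)"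
proof -
  \<comment> \<open>This is the closed form at t = y/2, whence the factor 1/4 before the
    logarithms.\<close>
  have *: "(\<lambda>k. binomial_harm_term (\<lambda>n. (2 - 2 * cos y) ^ n) (Suc k)) sums
          (zeta 3 - clausen_cos y + y\<^sup>2 * ln (2 - 2 * cos y) / 4)" if "0 < y" "y < pi" for y
    using binomial_harm_sums[of "y / 2"] that two_minus_two_cos[of "y / 2"]
    by (simp add: zeta_3_eq power_divide)
  have "a = (\<lambda>n. x\<^sub>1 ^ n + x\<^sub>2 ^ n)"
    using a by blast
  with sums_add[OF *[OF y(1,2)] *[OF y(3,4)]] show ?thesis
    using C by (simp add: x binomial_harm_term_add algebra_simps add_divide_distrib)
qed

section \<open>Special values of the cosine and of \<open>clausen_cos\<close>\<close>

lemma
  shows cos_pi_5: "cos (pi / 5) = (sqrt 5 + 1) / 4"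
    and cos_2pi_5: "cos (2 * pi / 5) = (sqrt 5 - 1) / 4"
proof -
  define c where "c = cos (pi / 5)"
  have "c > 0"
    unfolding c_def by (rule cos_gt_zero) auto
  have c2: "cos (2 * pi / 5) = 2 * c\<^sup>2 - 1"
    using cos_double_cos[of "pi / 5"] by (simp add: c_def)
  \<comment> \<open>Comparing the triple-angle formula with cos(3 pi/5) = - cos(2 pi/5) gives a
    cubic for c; positivity of c discards its root -1.\<close>
  have "cos (3 * pi / 5) = 4 * c ^ 3 - 3 * c"
    using cos_treble_cos[of "pi / 5"] by (simp add: c_def)
  moreover have "cos (3 * pi / 5) = - cos (2 * pi / 5)"
    using cos_minus_pi[of "2 * pi / 5"] by (simp add: field_simps cos_pi_minus)
  ultimately have "(c + 1) * (4 * c\<^sup>2 - 2 * c - 1) = 0"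
    using c2 by (simp add: algebra_simps power2_eq_square power3_eq_cube)
  then have quad: "4 * c\<^sup>2 - 2 * c - 1 = 0"
    using \<open>c > 0\<close> by simp
  then have "(4 * c - 1)\<^sup>2 = 5"
    by (simp add: power2_eq_square algebra_simps)
  \<comment> \<open>Selects the sign of the square root: the quadratic says 2c(2c - 1) = 1, so a
    small positive c is impossible.\<close>
  moreover have "4 * c - 1 \<ge> 0"
  proof (rule ccontr)
    assume "\<not> 4 * c - 1 \<ge> 0"
    then have "c * (4 * c - 2) \<le> 0"
      using \<open>c > 0\<close> by (intro mult_nonneg_nonpos) auto
    then show False
      using quad by (simp add: power2_eq_square algebra_simps)
  qed
  ultimately have "4 * c - 1 = sqrt 5"
    by (metis real_sqrt_abs abs_of_nonneg)
  then show "cos (pi / 5) = (sqrt 5 + 1) / 4" "cos (2 * pi / 5) = (sqrt 5 - 1) / 4"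
    using quad unfolding c2 c_def[symmetric] by simp_all
qed

lemma clausen_cos_2pi_minus: "clausen_cos (2 * pi - y) = clausen_cos y"
proof -
  have "cos (real n * (2 * pi - y)) = cos (real n * y)" for n
  proof -
    have "cos (real n * (2 * pi - y)) = cos (2 * real n * pi - real n * y)"
      by (simp add: algebra_simps)
    also have "\<dots> = cos (real n * y)"
      unfolding cos_diff by (simp only: cos_2npi sin_2npi mult_1_left mult_zero_left add_0_right)
    finally show ?thesis .
  qed
  then show ?thesis
    by (simp add: clausen_cos_def)
qed

text \<open>The distribution relation for m = 2 pairs y with y + pi, and the reflection replaces y +
  pi by pi - y.\<close>

lemma clausen_cos_duplication: "clausen_cos y + clausen_cos (pi - y) = clausen_cos (2 * y) / 4"
  using clausen_cos_distribution[of 2 y] clausen_cos_2pi_minus[of "pi - y"]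
  by (simp add: lessThan_nat_numeral add.commute)

text \<open>Write C for \<open>clausen_cos\<close>. Duplication at 0 and pi/2 gives C(pi) and
  C(pi/2). At y = 0 the distribution relation for m = 3 and m = 5 has its nonzero shifts paired by
  reflection; this gives C(2 pi/3), hence C(pi/3) by duplication, and the sum for fifths.\<close>

lemma
  shows clausen_cos_pi: "clausen_cos pi = - 3 / 4 * zeta 3"
    and clausen_cos_pi_2: "clausen_cos (pi / 2) = - 3 / 32 * zeta 3"
    and clausen_cos_pi_3: "clausen_cos (pi / 3) = 1 / 3 * zeta 3"
    and clausen_cos_2pi_5: "clausen_cos (2 * pi / 5) + clausen_cos (4 * pi / 5) = - 12 / 25 * zeta 3"
proof -
  show pi: "clausen_cos pi = - 3 / 4 * zeta 3"
    using clausen_cos_duplication[of 0] by (simp add: zeta_3_eq)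
  show "clausen_cos (pi / 2) = - 3 / 32 * zeta 3"
    using clausen_cos_duplication[of "pi / 2"] pi by simp
  have "clausen_cos (2 * pi / 3) = - 4 / 9 * zeta 3"
    using clausen_cos_distribution[of 3 0] clausen_cos_2pi_minus[of "2 * pi / 3"]
    by (simp add: lessThan_nat_numeral zeta_3_eq)
  then show "clausen_cos (pi / 3) = 1 / 3 * zeta 3"
    using clausen_cos_duplication[of "pi / 3"] by simp
  show "clausen_cos (2 * pi / 5) + clausen_cos (4 * pi / 5) = - 12 / 25 * zeta 3"
    using clausen_cos_distribution[of 5 0] clausen_cos_2pi_minus[of "2 * pi / 5"]
      clausen_cos_2pi_minus[of "4 * pi / 5"]
    by (simp add: lessThan_nat_numeral zeta_3_eq)
qed

theorem theorem5p1:
  fixes \<phi> :: real and L :: "nat \<Rightarrow> real"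
  assumes phi: "\<phi> = (sqrt 5 + 1) / 2"
    and L: "\<And>n. L (2 * n) = \<phi> ^ (2 * n) + \<phi> powi (- int (2 * n))"
  shows "((\<lambda>k. binomial_harm_term (\<lambda>n. L (2 * n)) (Suc k)) sums
           ((41 * zeta 3 + 4 * pi\<^sup>2 * ln \<phi>) / 25)) \<and>
         ((\<lambda>k. binomial_harm_term (\<lambda>n. of_int (lucas_v 5 5 n)) (Suc k)) sums
           ((124 * zeta 3 + pi\<^sup>2 * ln (5 ^ 5 * \<phi> ^ 6)) / 50)) \<and>
         ((\<lambda>k. binomial_harm_term (\<lambda>n. of_int (lucas_v 4 1 n)) (Suc k)) sums
           ((23 * zeta 3 + 2 * pi\<^sup>2 * ln (2 + sqrt 3)) / 12)) \<and>
         ((\<lambda>k. binomial_harm_term (\<lambda>n. of_int (lucas_v 4 2 n)) (Suc k)) sums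
           ((259 * zeta 3 + 2 * pi\<^sup>2 * (5 * ln 2 + 8 * ln (1 + sqrt 2))) / 128))"
proof (intro conjI)
  have \<phi>_pos: "\<phi> > 0"
    by (simp add: phi add_pos_pos)
  have \<phi>_sq: "\<phi>\<^sup>2 = (3 + sqrt 5) / 2"
    by (simp add: phi power2_eq_square algebra_simps)
  have \<phi>_inverse: "inverse \<phi> = (sqrt 5 - 1) / 2"
    by (rule inverse_unique) (simp add: phi algebra_simps)
  have \<phi>_inverse_sq: "inverse \<phi> ^ 2 = (3 - sqrt 5) / 2"
    unfolding \<phi>_inverse by (simp add: power2_eq_square field_simps)
  have cos_3pi_5: "cos (3 * pi / 5) = - (sqrt 5 - 1) / 4"
  proof -
    have "cos (3 * pi / 5) = cos (pi - 2 * pi / 5)"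
      by (rule arg_cong[where f = cos]) simp
    then show ?thesis
      by (simp only: cos_pi_minus cos_2pi_5 minus_divide_left)
  qed
  have cos_4pi_5: "cos (4 * pi / 5) = - (sqrt 5 + 1) / 4"
    using cos_pi_minus[of "pi / 5"] by (simp add: cos_pi_5 field_simps)
  have cos_5pi_6: "cos (5 * pi / 6) = - sqrt 3 / 2"
    using cos_pi_minus[of "pi / 6"] by (simp add: cos_30 field_simps)
  have cos_3pi_4: "cos (3 * pi / 4) = - sqrt 2 / 2"
    using cos_pi_minus[of "pi / 4"] by (simp add: cos_45 field_simps)

  show "(\<lambda>k. binomial_harm_term (\<lambda>n. L (2 * n)) (Suc k)) sums ((41 * zeta 3 + 4 * pi\<^sup>2 * ln \<phi>) / 25)"
  proof -
    have ln: "ln (\<phi>\<^sup>2) = 2 * ln \<phi>" "ln (inverse \<phi> ^ 2) = - (2 * ln \<phi>)"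
      using \<phi>_pos ln_realpow[of \<phi> 2] ln_realpow[of "inverse \<phi>" 2] by (simp_all add: ln_inverse)
    \<comment> \<open>The angles come from \<phi>^(-2) = 2 - 2 cos(pi/5) and \<phi>^2 = 2 - 2 cos(3
      pi/5).\<close>
    have "(\<lambda>k. binomial_harm_term (\<lambda>n. L (2 * n)) (Suc k)) sums
        ((2 - 9 / 25) * zeta 3 + ((pi / 5)\<^sup>2 * ln (inverse \<phi> ^ 2) + (3 * pi / 5)\<^sup>2 * ln (\<phi>\<^sup>2)) / 4)"
    proof (rule binomial_harm_power_sum_sums)
      show "L (2 * n) = (inverse \<phi> ^ 2) ^ n + (\<phi>\<^sup>2) ^ n" for n
        by (simp only: L power_int_minus power_int_of_nat power_mult power_inverse add.commute)
      \<comment> \<open>Adding the duplication formulas at pi/5 and 2 pi/5 expresses this sum as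
        -3/4 times the one over 2 pi/5 and 4 pi/5.\<close>
      show "clausen_cos (pi / 5) + clausen_cos (3 * pi / 5) = 9 / 25 * zeta 3"
        using clausen_cos_duplication[of "pi / 5"] clausen_cos_duplication[of "2 * pi / 5"] clausen_cos_2pi_5
        by (simp add: field_simps)
    qed (simp_all only: \<phi>_sq \<phi>_inverse_sq cos_pi_5 cos_3pi_5, simp_all add: field_simps)
    also have "\<dots> = (41 * zeta 3 + 4 * pi\<^sup>2 * ln \<phi>) / 25"
      unfolding ln by (simp add: power2_eq_square field_simps)
    finally show ?thesis .
  qed

  show "(\<lambda>k. binomial_harm_term (\<lambda>n. of_int (lucas_v 5 5 n)) (Suc k)) sums
      ((124 * zeta 3 + pi\<^sup>2 * ln (5 ^ 5 * \<phi> ^ 6)) / 50)"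
  proof -
    \<comment> \<open>The roots of x^2 - 5x + 5 are sqrt 5 times \<phi>^(-1) and \<phi>, which
      splits both logarithms.\<close>
    have ln1: "ln ((5 - sqrt 5) / 2) = ln 5 / 2 - ln \<phi>"
    proof -
      have "(5 - sqrt 5) / 2 = sqrt 5 * inverse \<phi>"
        unfolding \<phi>_inverse by (simp add: algebra_simps)
      then show ?thesis
        using \<phi>_pos by (simp add: ln_mult ln_inverse ln_sqrt)
    qed
    have ln2: "ln ((5 + sqrt 5) / 2) = ln 5 / 2 + ln \<phi>"
    proof -
      have "(5 + sqrt 5) / 2 = sqrt 5 * \<phi>"
        unfolding phi by (simp add: algebra_simps)
      then show ?thesis
        using \<phi>_pos by (simp add: ln_mult ln_sqrt)
    qed
    have ln3: "ln (5 ^ 5 * \<phi> ^ 6) = 5 * ln 5 + 6 * ln \<phi>"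
      using \<phi>_pos ln_realpow[of 5 5] by (simp add: ln_mult ln_realpow)
    have "(\<lambda>k. binomial_harm_term (\<lambda>n. of_int (lucas_v 5 5 n)) (Suc k)) sums
        ((2 - (- 12 / 25)) * zeta 3 +
         ((2 * pi / 5)\<^sup>2 * ln ((5 - sqrt 5) / 2) + (4 * pi / 5)\<^sup>2 * ln ((5 + sqrt 5) / 2)) / 4)"
    proof (rule binomial_harm_power_sum_sums)
      show "of_int (lucas_v 5 5 n) = ((5 - sqrt 5) / 2) ^ n + ((5 + sqrt 5) / 2) ^ n" for n
        by (rule lucas_v_eq_power_sum) (simp_all add: field_simps)
      show "clausen_cos (2 * pi / 5) + clausen_cos (4 * pi / 5) = - 12 / 25 * zeta 3"
        by (rule clausen_cos_2pi_5)
    qed (simp_all only: cos_2pi_5 cos_4pi_5, simp_all add: field_simps)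
    also have "\<dots> = (124 * zeta 3 + pi\<^sup>2 * ln (5 ^ 5 * \<phi> ^ 6)) / 50"
      unfolding ln1 ln2 ln3 by (simp add: power2_eq_square field_simps)
    finally show ?thesis .
  qed

  show "(\<lambda>k. binomial_harm_term (\<lambda>n. of_int (lucas_v 4 1 n)) (Suc k)) sums
      ((23 * zeta 3 + 2 * pi\<^sup>2 * ln (2 + sqrt 3)) / 12)"
  proof -
    \<comment> \<open>The roots of x^2 - 4x + 1 are reciprocal, so one logarithm suffices, weighted
      by the difference of the squared angles pi/6 and 5 pi/6.\<close>
    have ln: "ln (2 - sqrt 3) = - ln (2 + sqrt 3)"
    proof -
      have "2 - sqrt 3 = inverse (2 + sqrt 3)"
        by (rule inverse_unique[symmetric]) (simp add: algebra_simps)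
      then show ?thesis
        by (simp add: ln_inverse add_pos_pos)
    qed
    have "(\<lambda>k. binomial_harm_term (\<lambda>n. of_int (lucas_v 4 1 n)) (Suc k)) sums
        ((2 - 1 / 12) * zeta 3 + ((pi / 6)\<^sup>2 * ln (2 - sqrt 3) + (5 * pi / 6)\<^sup>2 * ln (2 + sqrt 3)) / 4)"
    proof (rule binomial_harm_power_sum_sums)
      show "of_int (lucas_v 4 1 n) = (2 - sqrt 3) ^ n + (2 + sqrt 3) ^ n" for n
        by (rule lucas_v_eq_power_sum) (simp_all add: algebra_simps)
      show "clausen_cos (pi / 6) + clausen_cos (5 * pi / 6) = 1 / 12 * zeta 3"
        using clausen_cos_duplication[of "pi / 6"] clausen_cos_pi_3 by simp
    qed (simp_all add: cos_30 cos_5pi_6)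
    also have "\<dots> = (23 * zeta 3 + 2 * pi\<^sup>2 * ln (2 + sqrt 3)) / 12"
      unfolding ln by (simp add: power2_eq_square field_simps)
    finally show ?thesis .
  qed

  show "(\<lambda>k. binomial_harm_term (\<lambda>n. of_int (lucas_v 4 2 n)) (Suc k)) sums
      ((259 * zeta 3 + 2 * pi\<^sup>2 * (5 * ln 2 + 8 * ln (1 + sqrt 2))) / 128)"
  proof -
    have pos: "1 + sqrt 2 > 0"
      by (simp add: add_pos_pos)
    \<comment> \<open>The roots of x^2 - 4x + 2 are sqrt 2 times 1 + sqrt 2 and its inverse; they
      belong to the angles 3 pi/4 and pi/4.\<close>
    have ln1: "ln (2 + sqrt 2) = ln 2 / 2 + ln (1 + sqrt 2)"
    proof -
      have "2 + sqrt 2 = sqrt 2 * (1 + sqrt 2)"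
        by (simp add: algebra_simps)
      then show ?thesis
        using pos less_imp_neq[OF pos] by (simp add: ln_mult ln_sqrt)
    qed
    have ln2: "ln (2 - sqrt 2) = ln 2 / 2 - ln (1 + sqrt 2)"
    proof -
      have inverse: "inverse (1 + sqrt 2) = sqrt 2 - 1"
        by (rule inverse_unique) (simp add: algebra_simps)
      have "2 - sqrt 2 = sqrt 2 * inverse (1 + sqrt 2)"
        unfolding inverse by (simp add: algebra_simps)
      then show ?thesis
        using pos less_imp_neq[OF pos] by (simp add: ln_mult ln_inverse ln_sqrt)
    qed
    have "(\<lambda>k. binomial_harm_term (\<lambda>n. of_int (lucas_v 4 2 n)) (Suc k)) sums
        ((2 - (- 3 / 128)) * zeta 3 + ((pi / 4)\<^sup>2 * ln (2 - sqrt 2) + (3 * pi / 4)\<^sup>2 * ln (2 + sqrt 2)) / 4)"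
    proof (rule binomial_harm_power_sum_sums)
      show "of_int (lucas_v 4 2 n) = (2 - sqrt 2) ^ n + (2 + sqrt 2) ^ n" for n
        by (rule lucas_v_eq_power_sum) (simp_all add: algebra_simps)
      show "clausen_cos (pi / 4) + clausen_cos (3 * pi / 4) = - 3 / 128 * zeta 3"
        using clausen_cos_duplication[of "pi / 4"] clausen_cos_pi_2 by simp
    qed (simp_all add: cos_45 cos_3pi_4)
    also have "\<dots> = (259 * zeta 3 + 2 * pi\<^sup>2 * (5 * ln 2 + 8 * ln (1 + sqrt 2))) / 128"
      unfolding ln1 ln2 by (simp add: power2_eq_square field_simps)
    finally show ?thesis .
  qed
qed

end
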